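(* Consider the $d$-dimensional Euler equations closed by an arbitrary equation of state. Let $\widetilde\nabla(p\beta)$ and $\widetilde\nabla(g\beta)$ be symmetric discrete gradients, with respect to $(\rho,\beta)$, of $p\beta$ and $g\beta$, such that $\widetilde\nabla_\rho(p\beta)>0$ and $\widetilde\nabla_\rho(g\beta)>0$ at all pairs of states, and let the numerical flux $\boldsymbol f_h^i=[f_\rho^i,(f_{\boldsymbol m}^i)^T,f_E^i]^T$, $i=1,\dots,d$, be given by $$f_\rho^i=\widetilde\rho\,\overline v_i,\qquad f_{\boldsymbol m}^i=f_\rho^i\,\overline{\boldsymbol v}+\overline p\,\boldsymbol\delta_i,\qquad f_E^i=f_\rho^i\,\widetilde e+f_\rho^i\Big(\|\overline{\boldsymbol v}\|^2-\tfrac12\overline{\|\boldsymbol v\|^2}\Big)+\big(2\,\overline v_i\,\overline p-\overline{v_ip}\big),$$ $$\widetilde\rho=\frac{\widetilde\nabla_\rho(p\beta)}{\widetilde\nabla_\rho(g\beta)},\qquad \widetilde e=\widetilde\nabla_\beta(g\beta)-\frac{\widetilde\nabla_\beta(p\beta)}{\widetilde\rho}.$$ Then every solution $(\boldsymbol u_{\boldsymbol I}(t))_{\boldsymbol I}$ in $\mathcal U$ of the finite-volume scheme $$\frac{d\boldsymbol u_{\boldsymbol I}}{dt}+\sum_{j=1}^d\frac1{\Delta x_j}\Big(\boldsymbol f_h^j(\boldsymbol u_{\boldsymbol I},\boldsymbol u_{\boldsymbol I+\boldsymbol 1_j})-\boldsymbol f_h^j(\boldsymbol u_{\boldsymbol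 I-\boldsymbol 1_j},\boldsymbol u_{\boldsymbol I})\Big)=0$$ satisfies: (a) (kinetic-energy consistency) with $k_{\boldsymbol I}=k(\boldsymbol u_{\boldsymbol I})$ and the numerical work term $W_k^j:=\overline v_j\,\Delta p$, $$\frac{dk_{\boldsymbol I}}{dt}+\sum_{j=1}^d\frac{\mathcal F^j_{k,\boldsymbol I+\boldsymbol 1_j/2}-\mathcal F^j_{k,\boldsymbol I-\boldsymbol 1_j/2}}{\Delta x_j}+\sum_{j=1}^d\frac{W^j_{k,\boldsymbol I+\boldsymbol 1_j/2}+W^j_{k,\boldsymbol I-\boldsymbol 1_j/2}}{2\Delta x_j}=0,$$ where $\mathcal F_{k,h}^j$ is a symmetric two-point function with $\mathcal F_{k,h}^j(\boldsymbol u,\boldsymbol u)=k(\boldsymbol u)v_j(\boldsymbol u)$, namely $\mathcal F_{k,h}^j=\overline{\boldsymbol\kappa}^T\boldsymbol f_h^j-\overline{p v_j}$ with $\boldsymbol\kappa=\partial k/\partial\boldsymbol u$; (b) (entropy conservation) with $s_{\boldsymbol I}=s(\boldsymbol u_{\boldsymbol I})$, $$\frac{ds_{\boldsymbol I}}{dt}+\sum_{j=1}^d\frac{\mathcal F^j_{s,\boldsymbol I+\boldsymbol 1_j/2}-\mathcal F^j_{s,\boldsymbol I-\boldsymbol 1_j/2}}{\Delta x_j}=0,$$ where $\mathcal F_{s,h}^j$ is a symmetric two-point function with $\mathcal F_{s,h}^j(\boldsymbol u,\boldsymbol u)=s(\boldsymbol u)v_j(\boldsymbol u)$, namely $\mathcal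 F_{s,h}^j=\overline{\boldsymbol\eta}^T\boldsymbol f_h^j-\overline{v_jp\beta}$ with $\boldsymbol\eta=\partial s/\partial\boldsymbol u$.
   Context: Euler equations: $\boldsymbol u=[\rho,\boldsymbol m^T,E]^T\in\mathcal U\subseteq\mathbb R^{d+2}$ (open), $\rho>0$, with fluxes $\boldsymbol f^i(\boldsymbol u)=[m_i,\ (v_i\boldsymbol m+p\boldsymbol\delta_i)^T,\ v_i(E+p)]^T$, velocity $\boldsymbol v=\boldsymbol m/\rho$, and $\boldsymbol\delta_i$ the $i$-th unit vector of $\mathbb R^d$. Equation of state (EoS): given by a specific Helmholtz energy $\mathcal A(\rho,T)$ of class $C^2$ on an open set $\mathcal T\subseteq(0,\infty)^2$. Pressure $p=\rho^2\partial_\rho\mathcal A$, specific entropy $\sigma=-\partial_T\mathcal A$, specific internal energy $e=\mathcal A-T\partial_T\mathcal A$, specific Gibbs energy $g=\mathcal A+\rho\,\partial_\rho\mathcal A$. It is assumed that $\partial_Te>0$ and that every $\boldsymbol u\in\mathcal U$ determines a unique temperature $T(\boldsymbol u)$ with $(\rho,T)\in\mathcal T$ by $E-\frac{\|\boldsymbol m\|^2}{2\rho}=\rho\,e(\rho,T)$; thermodynamic quantities are thereby functions of $\boldsymbol u$. Put $\beta=1/T$. Kinetic energy density $k(\boldsymbol u)=\frac12\|\boldsymbol m\|^2/\rho$; mathematical entropy $s(\boldsymbol u)=-\rho\,\sigma(\boldsymbol u)$. "Arbitrary EoS" means an arbitrary function $\mathcal A(\rho,T)$ of class $C^2$ on an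 open set $\mathcal T\subseteq(0,\infty)^2$ such that $e=\mathcal A-T\partial_T\mathcal A$ satisfies $\partial_Te>0$ on $\mathcal T$ and every $\boldsymbol u\in\mathcal U$ determines a unique temperature $T(\boldsymbol u)$ with $(\rho,T(\boldsymbol u))\in\mathcal T$ and $E-\frac{\|\boldsymbol m\|^2}{2\rho}=\rho\,e(\rho,T(\boldsymbol u))$. Two-point notation: for states $\boldsymbol u_1,\boldsymbol u_2$ and a function $a$ of the state, $\overline a=\frac12(a(\boldsymbol u_1)+a(\boldsymbol u_2))$ and $\Delta a=a(\boldsymbol u_2)-a(\boldsymbol u_1)$; e.g. $\overline{v_ip}$ is the mean of the product. Discrete gradient: for a differentiable $\phi:\mathcal P\to\mathbb R$, $\mathcal P\subseteq\mathbb R^m$ open, a continuous map $\widetilde\nabla\phi:\mathcal P\times\mathcal P\to\mathbb R^m$ with $\widetilde\nabla\phi(\boldsymbol p_1,\boldsymbol p_2)^T(\boldsymbol p_2-\boldsymbol p_1)=\phi(\boldsymbol p_2)-\phi(\boldsymbol p_1)$ and $\widetilde\nabla\phi(\boldsymbol p,\boldsymbol p)=\nabla\phi(\boldsymbol p)$. It is symmetric if $\widetilde\nabla\phi(\boldsymbol p_1,\boldsymbol p_2)=\widetilde\nabla\phi(\boldsymbol p_2,\boldsymbol p_1)$. Here $p\beta$ and $g\beta$ are regarded as functions of $(\rho,\beta)$, and $\widetilde\nabla_\rho,\widetilde\nabla_\beta$ denote the two components of the discrete gradient, evaluated at $(\rho_1,\beta_1),(\rho_2,\beta_2)$. Grid: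 cells are indexed by multi-indices $\boldsymbol I$; $\boldsymbol 1_j$ has $1$ in position $j$ and $0$ elsewhere; $\Delta x_j>0$ are uniform cell widths. For a two-point function $\phi$, $\phi_{\boldsymbol I+\boldsymbol 1_j/2}=\phi(\boldsymbol u_{\boldsymbol I},\boldsymbol u_{\boldsymbol I+\boldsymbol 1_j})$ and $\phi_{\boldsymbol I-\boldsymbol 1_j/2}=\phi(\boldsymbol u_{\boldsymbol I-\boldsymbol 1_j},\boldsymbol u_{\boldsymbol I})$; $\mathcal F^j_{k,\boldsymbol I\pm\boldsymbol 1_j/2}$ and $\mathcal F^j_{s,\boldsymbol I\pm\boldsymbol 1_j/2}$ are formed from $\mathcal F^j_{k,h}$ and $\mathcal F^j_{s,h}$ in this way. Equations hold at every cell having all its neighbours (e.g. all cells of a periodic grid). *)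

theory Defs
  imports "HOL-Analysis.Analysis"
begin

section \<open>Differentiability classes and gradients\<close>

text \<open>Both predicates are meant for open sets.\<close>

definition C1_on :: "('a::euclidean_space \<Rightarrow> real) \<Rightarrow> 'a set \<Rightarrow> bool" where
  "C1_on f S \<longleftrightarrow>
     (\<forall>x\<in>S. f differentiable (at x)) \<and>
     (\<forall>h. continuous_on S (\<lambda>x. frechet_derivative f (at x) h))"

definition C2_on :: "('a::euclidean_space \<Rightarrow> real) \<Rightarrow> 'a set \<Rightarrow> bool" where
  "C2_on f S \<longleftrightarrow>
     (\<forall>x\<in>S. f differentiable (at x)) \<and>
     (\<forall>h. C1_on (\<lambda>x. frechet_derivative f (at x) h) S)"

definition grad :: "('a::euclidean_space \<Rightarrow> real) \<Rightarrow> 'a \<Rightarrow> 'a" where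
  "grad f x = (THE D. GDERIV f x :> D)"

definition discrete_gradient ::
    "('a::euclidean_space \<Rightarrow> real) \<Rightarrow> 'a set \<Rightarrow> ('a \<Rightarrow> 'a \<Rightarrow> 'a) \<Rightarrow> bool" where
  "discrete_gradient \<phi> P G \<longleftrightarrow>
     open P \<and> (\<forall>x\<in>P. \<phi> differentiable (at x)) \<and>
     continuous_on (P \<times> P) (\<lambda>(x, y). G x y) \<and>
     (\<forall>x\<in>P. \<forall>y\<in>P. inner (G x y) (y - x) = \<phi> y - \<phi> x) \<and>
     (\<forall>x\<in>P. G x x = grad \<phi> x)"

definition symmetric_on :: "'a set \<Rightarrow> ('a \<Rightarrow> 'a \<Rightarrow> 'b) \<Rightarrow> bool" where
  "symmetric_on P F \<longleftrightarrow> (\<forall>x\<in>P. \<forall>y\<in>P. F x y = F y x)"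

section \<open>Equation of state\<close>

text \<open>The argument \<open>A\<close> is the specific Helmholtz energy as a function of density and
  temperature.\<close>

definition eos_p :: "(real \<Rightarrow> real \<Rightarrow> real) \<Rightarrow> real \<Rightarrow> real \<Rightarrow> real" where
  "eos_p A \<rho> T = \<rho>\<^sup>2 * deriv (\<lambda>r. A r T) \<rho>"

definition eos_\<sigma> :: "(real \<Rightarrow> real \<Rightarrow> real) \<Rightarrow> real \<Rightarrow> real \<Rightarrow> real" where
  "eos_\<sigma> A \<rho> T = - deriv (\<lambda>\<tau>. A \<rho> \<tau>) T"

definition eos_e :: "(real \<Rightarrow> real \<Rightarrow> real) \<Rightarrow> real \<Rightarrow> real \<Rightarrow> real" where
  "eos_e A \<rho> T = A \<rho> T - T * deriv (\<lambda>\<tau>. A \<rho> \<tau>) T"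

definition eos_g :: "(real \<Rightarrow> real \<Rightarrow> real) \<Rightarrow> real \<Rightarrow> real \<Rightarrow> real" where
  "eos_g A \<rho> T = A \<rho> T + \<rho> * deriv (\<lambda>r. A r T) \<rho>"

text \<open>The quantities \<open>p \<beta>\<close> and \<open>g \<beta>\<close> as functions of \<open>(\<rho>, \<beta>)\<close>, and the image of the
  domain of the equation of state under \<open>(\<rho>, T) \<mapsto> (\<rho>, 1 / T)\<close>.\<close>

definition p\<beta> :: "(real \<Rightarrow> real \<Rightarrow> real) \<Rightarrow> real \<times> real \<Rightarrow> real" where
  "p\<beta> A = (\<lambda>(\<rho>, \<beta>). eos_p A \<rho> (1 / \<beta>) * \<beta>)"

definition g\<beta> :: "(real \<Rightarrow> real \<Rightarrow> real) \<Rightarrow> real \<times> real \<Rightarrow> real" where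
  "g\<beta> A = (\<lambda>(\<rho>, \<beta>). eos_g A \<rho> (1 / \<beta>) * \<beta>)"

definition \<rho>\<beta>_domain :: "(real \<times> real) set \<Rightarrow> (real \<times> real) set" where
  "\<rho>\<beta>_domain \<T> = (\<lambda>(\<rho>, T). (\<rho>, 1 / T)) ` \<T>"

section \<open>States\<close>

text \<open>A state is \<open>(\<rho>, m, E)\<close>; the dimension \<open>d\<close> is \<open>CARD('d)\<close>.\<close>

type_synonym 'd state = "real \<times> (real ^ 'd) \<times> real"

definition dens :: "('d::finite) state \<Rightarrow> real" where "dens u = fst u"
definition mom :: "('d::finite) state \<Rightarrow> real ^ 'd" where "mom u = fst (snd u)"
definition energy :: "('d::finite) state \<Rightarrow> real" where "energy u = snd (snd u)"

definition vel :: "('d::finite) state \<Rightarrow> real ^ 'd" where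
  "vel u = (1 / dens u) *\<^sub>R mom u"

definition kin :: "('d::finite) state \<Rightarrow> real" where
  "kin u = (1 / 2) * (norm (mom u))\<^sup>2 / dens u"

definition is_temperature ::
    "(real \<times> real) set \<Rightarrow> (real \<Rightarrow> real \<Rightarrow> real) \<Rightarrow> ('d::finite) state \<Rightarrow> real \<Rightarrow> bool" where
  "is_temperature \<T> A u T \<longleftrightarrow>
     (dens u, T) \<in> \<T> \<and>
     energy u - (norm (mom u))\<^sup>2 / (2 * dens u) = dens u * eos_e A (dens u) T"

definition temp :: "(real \<times> real) set \<Rightarrow> (real \<Rightarrow> real \<Rightarrow> real) \<Rightarrow> ('d::finite) state \<Rightarrow> real" where
  "temp \<T> A u = (THE T. is_temperature \<T> A u T)"

definition arbitrary_eos ::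
    "(real \<times> real) set \<Rightarrow> (real \<Rightarrow> real \<Rightarrow> real) \<Rightarrow> ('d::finite) state set \<Rightarrow> bool" where
  "arbitrary_eos \<T> A \<U> \<longleftrightarrow>
     open \<T> \<and> \<T> \<subseteq> {0<..} \<times> {0<..} \<and>
     C2_on (\<lambda>(\<rho>, T). A \<rho> T) \<T> \<and>
     (\<forall>(\<rho>, T)\<in>\<T>. deriv (\<lambda>\<tau>. eos_e A \<rho> \<tau>) T > 0) \<and>
     (\<forall>u\<in>\<U>. \<exists>!T. is_temperature \<T> A u T)"

definition beta :: "(real \<times> real) set \<Rightarrow> (real \<Rightarrow> real \<Rightarrow> real) \<Rightarrow> ('d::finite) state \<Rightarrow> real" where
  "beta \<T> A u = 1 / temp \<T> A u"

definition pres :: "(real \<times> real) set \<Rightarrow> (real \<Rightarrow> real \<Rightarrow> real) \<Rightarrow> ('d::finite) state \<Rightarrow> real" where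
  "pres \<T> A u = eos_p A (dens u) (temp \<T> A u)"

definition entropy :: "(real \<times> real) set \<Rightarrow> (real \<Rightarrow> real \<Rightarrow> real) \<Rightarrow> ('d::finite) state \<Rightarrow> real" where
  "entropy \<T> A u = - dens u * eos_\<sigma> A (dens u) (temp \<T> A u)"

definition \<rho>\<beta> ::
    "(real \<times> real) set \<Rightarrow> (real \<Rightarrow> real \<Rightarrow> real) \<Rightarrow> ('d::finite) state \<Rightarrow> real \<times> real" where
  "\<rho>\<beta> \<T> A u = (dens u, beta \<T> A u)"

section \<open>Two-point functions\<close>

definition avg :: "('s \<Rightarrow> 'b::real_vector) \<Rightarrow> 's \<Rightarrow> 's \<Rightarrow> 'b" where
  "avg a u1 u2 = (1 / 2) *\<^sub>R (a u1 + a u2)"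

definition jump :: "('s \<Rightarrow> 'b::real_vector) \<Rightarrow> 's \<Rightarrow> 's \<Rightarrow> 'b" where
  "jump a u1 u2 = a u2 - a u1"

text \<open>Below, \<open>Gp\<close> and \<open>Gg\<close> are discrete gradients of \<open>p \<beta>\<close> and \<open>g \<beta>\<close>; \<open>fst\<close> and \<open>snd\<close>
  select their \<open>\<rho>\<close>- and \<open>\<beta>\<close>-components.\<close>

type_synonym dgrad = "real \<times> real \<Rightarrow> real \<times> real \<Rightarrow> real \<times> real"

definition \<rho>_tilde ::
    "(real \<times> real) set \<Rightarrow> (real \<Rightarrow> real \<Rightarrow> real) \<Rightarrow> dgrad \<Rightarrow> dgrad
     \<Rightarrow> ('d::finite) state \<Rightarrow> 'd state \<Rightarrow> real" where
  "\<rho>_tilde \<T> A Gp Gg u1 u2 =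
     fst (Gp (\<rho>\<beta> \<T> A u1) (\<rho>\<beta> \<T> A u2)) / fst (Gg (\<rho>\<beta> \<T> A u1) (\<rho>\<beta> \<T> A u2))"

definition e_tilde ::
    "(real \<times> real) set \<Rightarrow> (real \<Rightarrow> real \<Rightarrow> real) \<Rightarrow> dgrad \<Rightarrow> dgrad
     \<Rightarrow> ('d::finite) state \<Rightarrow> 'd state \<Rightarrow> real" where
  "e_tilde \<T> A Gp Gg u1 u2 =
     snd (Gg (\<rho>\<beta> \<T> A u1) (\<rho>\<beta> \<T> A u2))
     - snd (Gp (\<rho>\<beta> \<T> A u1) (\<rho>\<beta> \<T> A u2)) / \<rho>_tilde \<T> A Gp Gg u1 u2"

definition flux_\<rho> ::
    "(real \<times> real) set \<Rightarrow> (real \<Rightarrow> real \<Rightarrow> real) \<Rightarrow> dgrad \<Rightarrow> dgrad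
     \<Rightarrow> 'd::finite \<Rightarrow> 'd state \<Rightarrow> 'd state \<Rightarrow> real" where
  "flux_\<rho> \<T> A Gp Gg i u1 u2 = \<rho>_tilde \<T> A Gp Gg u1 u2 * avg (\<lambda>u. vel u $ i) u1 u2"

definition flux_m ::
    "(real \<times> real) set \<Rightarrow> (real \<Rightarrow> real \<Rightarrow> real) \<Rightarrow> dgrad \<Rightarrow> dgrad
     \<Rightarrow> 'd::finite \<Rightarrow> 'd state \<Rightarrow> 'd state \<Rightarrow> real ^ 'd" where
  "flux_m \<T> A Gp Gg i u1 u2 =
     flux_\<rho> \<T> A Gp Gg i u1 u2 *\<^sub>R avg vel u1 u2 + avg (pres \<T> A) u1 u2 *\<^sub>R axis i 1"

definition flux_E ::
    "(real \<times> real) set \<Rightarrow> (real \<Rightarrow> real \<Rightarrow> real) \<Rightarrow> dgrad \<Rightarrow> dgrad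
     \<Rightarrow> 'd::finite \<Rightarrow> 'd state \<Rightarrow> 'd state \<Rightarrow> real" where
  "flux_E \<T> A Gp Gg i u1 u2 =
     flux_\<rho> \<T> A Gp Gg i u1 u2 * e_tilde \<T> A Gp Gg u1 u2
     + flux_\<rho> \<T> A Gp Gg i u1 u2 *
         ((norm (avg vel u1 u2))\<^sup>2 - (1 / 2) * avg (\<lambda>u. (norm (vel u))\<^sup>2) u1 u2)
     + (2 * avg (\<lambda>u. vel u $ i) u1 u2 * avg (pres \<T> A) u1 u2
        - avg (\<lambda>u. vel u $ i * pres \<T> A u) u1 u2)"

definition num_flux ::
    "(real \<times> real) set \<Rightarrow> (real \<Rightarrow> real \<Rightarrow> real) \<Rightarrow> dgrad \<Rightarrow> dgrad
     \<Rightarrow> 'd::finite \<Rightarrow> 'd state \<Rightarrow> 'd state \<Rightarrow> 'd state" where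
  "num_flux \<T> A Gp Gg i u1 u2 =
     (flux_\<rho> \<T> A Gp Gg i u1 u2, flux_m \<T> A Gp Gg i u1 u2, flux_E \<T> A Gp Gg i u1 u2)"

definition kin_work ::
    "(real \<times> real) set \<Rightarrow> (real \<Rightarrow> real \<Rightarrow> real) \<Rightarrow> 'd::finite \<Rightarrow> 'd state \<Rightarrow> 'd state \<Rightarrow> real" where
  "kin_work \<T> A j u1 u2 = avg (\<lambda>u. vel u $ j) u1 u2 * jump (pres \<T> A) u1 u2"

definition kin_flux ::
    "(real \<times> real) set \<Rightarrow> (real \<Rightarrow> real \<Rightarrow> real) \<Rightarrow> dgrad \<Rightarrow> dgrad
     \<Rightarrow> 'd::finite \<Rightarrow> 'd state \<Rightarrow> 'd state \<Rightarrow> real" where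
  "kin_flux \<T> A Gp Gg j u1 u2 =
     inner (avg (grad kin) u1 u2) (num_flux \<T> A Gp Gg j u1 u2)
     - avg (\<lambda>u. pres \<T> A u * vel u $ j) u1 u2"

definition entropy_flux ::
    "(real \<times> real) set \<Rightarrow> (real \<Rightarrow> real \<Rightarrow> real) \<Rightarrow> dgrad \<Rightarrow> dgrad
     \<Rightarrow> 'd::finite \<Rightarrow> 'd state \<Rightarrow> 'd state \<Rightarrow> real" where
  "entropy_flux \<T> A Gp Gg j u1 u2 =
     inner (avg (grad (entropy \<T> A)) u1 u2) (num_flux \<T> A Gp Gg j u1 u2)
     - avg (\<lambda>u. vel u $ j * pres \<T> A u * beta \<T> A u) u1 u2"

section \<open>Grid and scheme\<close>

text \<open>A grid is a set of cells in \<open>\<int>\<^sup>d\<close>. A periodic grid is the full lattice carrying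
  periodic data.\<close>

definition interior_cells :: "(int ^ 'd::finite) set \<Rightarrow> (int ^ 'd) set" where
  "interior_cells C = {I \<in> C. \<forall>j. I + axis j 1 \<in> C \<and> I - axis j 1 \<in> C}"

definition face_plus ::
    "('d state \<Rightarrow> 'd state \<Rightarrow> 'b) \<Rightarrow> (int ^ 'd \<Rightarrow> 'd state) \<Rightarrow> int ^ 'd \<Rightarrow> 'd::finite \<Rightarrow> 'b" where
  "face_plus \<phi> w I j = \<phi> (w I) (w (I + axis j 1))"

definition face_minus ::
    "('d state \<Rightarrow> 'd state \<Rightarrow> 'b) \<Rightarrow> (int ^ 'd \<Rightarrow> 'd state) \<Rightarrow> int ^ 'd \<Rightarrow> 'd::finite \<Rightarrow> 'b" where
  "face_minus \<phi> w I j = \<phi> (w (I - axis j 1)) (w I)"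

definition scheme_solution ::
    "('d \<Rightarrow> 'd state \<Rightarrow> 'd state \<Rightarrow> 'd state) \<Rightarrow> ('d \<Rightarrow> real) \<Rightarrow> (int ^ 'd::finite) set \<Rightarrow> real set
     \<Rightarrow> 'd state set \<Rightarrow> (int ^ 'd \<Rightarrow> real \<Rightarrow> 'd state) \<Rightarrow> bool" where
  "scheme_solution f \<Delta>x C J \<U> u \<longleftrightarrow>
     (\<forall>I\<in>C. \<forall>t\<in>J. u I t \<in> \<U>) \<and>
     (\<forall>I\<in>interior_cells C. \<forall>t\<in>J. \<exists>D.
        (u I has_vector_derivative D) (at t within J) \<and>
        D + (\<Sum>j\<in>UNIV. (1 / \<Delta>x j) *\<^sub>R
               (face_plus (f j) (\<lambda>K. u K t) I j - face_minus (f j) (\<lambda>K. u K t) I j)) = 0)"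

end

theory Submission
  imports Defs
begin

text \<open>
  Both balance laws are instances of one principle, due to Tadmor. Let \<open>\<phi>\<close> be a function of the
  state with gradient \<open>\<eta>\<close>. Along the semi-discrete scheme, \<open>\<phi>\<close> changes at the rate
  \<open>\<eta> \<bullet> du/dt\<close>, and each direction contributes to it the difference of \<open>\<eta> \<bullet> f\<close> between two opposite
  faces, with \<open>\<eta>\<close> taken in the cell. Replacing \<open>\<eta>\<close> by its mean over the face costs half of \<open>\<Delta>\<eta> \<bullet> f\<close>. If this jump equals
  \<open>\<Delta>\<psi> - W\<close> for a potential \<open>\<psi>\<close>, then half of \<open>\<Delta>\<psi>\<close> turns the mean of \<open>\<psi>\<close> at a face into its value in
  the cell, which cancels between the two faces. What remains is the conservative flux
  \<open>avg \<eta> \<bullet> f - avg \<psi>\<close> and the mean of the work \<open>W\<close> (lemma \<open>scheme_balance\<close>).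

  For the kinetic energy, \<open>\<eta> = (- |v|\<^sup>2 / 2, v, 0)\<close> and \<open>\<psi> = p v\<^sub>j\<close>. The form
  \<open>f\<^sub>\<rho> avg v + avg p \<delta>\<^sub>j\<close> of the momentum flux makes the convective parts of \<open>\<Delta>\<eta> \<bullet> f\<close> cancel and
  leaves \<open>avg p \<Delta>v\<^sub>j = \<Delta>(p v\<^sub>j) - avg v\<^sub>j \<Delta>p\<close> (lemma \<open>kin_jump\<close>).

  For the entropy, \<open>\<eta> = (\<beta> (g - |v|\<^sup>2 / 2), \<beta> v, - \<beta>)\<close> and \<open>\<psi> = v\<^sub>j p \<beta>\<close>. Here the two
  discrete gradients enter: the choice of \<open>\<rho>_tilde\<close> and \<open>e_tilde\<close> is exactly what makes
  \<open>\<rho>_tilde (\<Delta>(g \<beta>) - e_tilde \<Delta>\<beta>) = \<Delta>(p \<beta>)\<close> hold, a discrete Gibbs-Duhem relation. Everything else in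
  \<open>\<Delta>\<eta> \<bullet> f = \<Delta>\<psi>\<close> is product-rule algebra for jumps and means (lemma \<open>entropy_jump\<close>).

  The analytic part is to know that the entropy is a differentiable function of the state with
  this gradient. The temperature is defined only implicitly, by uniqueness, but \<open>\<partial>e/\<partial>T > 0\<close> forces
  it to be continuous (lemma \<open>temp_continuous\<close>), hence differentiable as a continuous local inverse of
  a map with invertible derivative (lemma \<open>temp_has_derivative\<close>). The Gibbs relation then gives the
  gradient (lemma \<open>entropy_GDERIV\<close>).

  Consistency of the two-point fluxes reduces to \<open>\<rho>_tilde = \<rho>\<close> and \<open>e_tilde = e\<close> on the diagonal,
  which follows from the gradient of \<open>p \<beta> = \<rho> (g \<beta> - \<beta> A)\<close> (lemma \<open>grad_p\<beta>\<close>).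
\<close>

section \<open>Gradients and partial derivatives\<close>

lemma GDERIV_unique:
  assumes "GDERIV f x :> D" "GDERIV f x :> D'"
  shows "D = D'"
proof -
  have "(\<lambda>h. inner h D) = (\<lambda>h. inner h D')"
    using assms unfolding gderiv_def by (rule has_derivative_unique)
  then have "inner (D - D') D = inner (D - D') D'"
    by metis
  then have "inner (D - D') (D - D') = 0"
    by (simp add: inner_diff_right)
  then show ?thesis
    by simp
qed

lemma grad_eqI: "GDERIV f x :> D \<Longrightarrow> grad f x = D"
  unfolding grad_def by (blast intro: GDERIV_unique)

lemma has_derivative_partials:
  fixes f :: "real \<times> real \<Rightarrow> real"
  assumes "f differentiable (at (x, y))"
  shows "(f has_derivative (\<lambda>h. fst h * deriv (\<lambda>r. f (r, y)) x + snd h * deriv (\<lambda>s. f (x, s)) y)) (at (x, y))"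
proof -
  obtain f' where f': "(f has_derivative f') (at (x, y))"
    using assms unfolding differentiable_def by blast
  interpret f': bounded_linear f'
    using f' by (rule has_derivative_bounded_linear)
  have lin: "f' (c *\<^sub>R h) = c * f' h" for c h
    by (simp add: f'.scaleR)
  have "((\<lambda>r. f (r, y)) has_derivative (\<lambda>h. f' (h, 0))) (at x)"
    by (rule has_derivative_compose[where f="\<lambda>r. (r, y)" and g=f, OF _ f'])
       (auto intro!: derivative_eq_intros)
  moreover have "(\<lambda>h. f' (h, 0)) = (*) (f' (1, 0))"
  proof
    show "f' (h, 0) = f' (1, 0) * h" for h
      using lin[of h "(1, 0)"] by (simp add: mult.commute)
  qed
  ultimately have "((\<lambda>r. f (r, y)) has_field_derivative f' (1, 0)) (at x)"
    by (simp only: has_field_derivative_def)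
  then have dx: "deriv (\<lambda>r. f (r, y)) x = f' (1, 0)"
    by (rule DERIV_imp_deriv)
  have "((\<lambda>s. f (x, s)) has_derivative (\<lambda>h. f' (0, h))) (at y)"
    by (rule has_derivative_compose[where f="\<lambda>s. (x, s)" and g=f, OF _ f'])
       (auto intro!: derivative_eq_intros)
  moreover have "(\<lambda>h. f' (0, h)) = (*) (f' (0, 1))"
  proof
    show "f' (0, h) = f' (0, 1) * h" for h
      using lin[of h "(0, 1)"] by (simp add: mult.commute)
  qed
  ultimately have "((\<lambda>s. f (x, s)) has_field_derivative f' (0, 1)) (at y)"
    by (simp only: has_field_derivative_def)
  then have dy: "deriv (\<lambda>s. f (x, s)) y = f' (0, 1)"
    by (rule DERIV_imp_deriv)
  have "f' = (\<lambda>h. fst h * f' (1, 0) + snd h * f' (0, 1))"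
  proof
    fix h
    have "h = fst h *\<^sub>R (1, 0) + snd h *\<^sub>R (0, 1)"
      by (simp add: prod_eq_iff)
    then have "f' h = f' (fst h *\<^sub>R (1, 0) + snd h *\<^sub>R (0, 1))"
      by (rule arg_cong)
    then show "f' h = fst h * f' (1, 0) + snd h * f' (0, 1)"
      by (simp only: f'.add lin)
  qed
  with f' have "(f has_derivative (\<lambda>h. fst h * f' (1, 0) + snd h * f' (0, 1))) (at (x, y))"
    by (rule has_derivative_eq_rhs)
  then show ?thesis
    by (simp only: dx dy)
qed

section \<open>Derivatives of the equation of state\<close>

lemma eos_A_has_derivative:
  assumes "C2_on (\<lambda>(\<rho>, T). A \<rho> T) \<T>" "(\<rho>, T) \<in> \<T>"
  shows "((\<lambda>(\<rho>, T). A \<rho> T) has_derivative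
      (\<lambda>h. fst h * deriv (\<lambda>r. A r T) \<rho> + snd h * deriv (\<lambda>\<tau>. A \<rho> \<tau>) T)) (at (\<rho>, T))"
proof -
  have "(\<lambda>(\<rho>, T). A \<rho> T) differentiable (at (\<rho>, T))"
    using assms unfolding C2_on_def by blast
  from has_derivative_partials[OF this] show ?thesis
    by simp
qed

text \<open>Twice differentiability of \<open>A\<close> is phrased through its total derivative, applied to a fixed
  vector; the entropy \<open>\<sigma>\<close> is that derivative in the direction \<open>(0, 1)\<close>, up to sign. The two agree
  only on \<open>\<T>\<close>, so openness is needed to transfer differentiability.\<close>

lemma eos_\<sigma>_differentiable:
  assumes "open \<T>" "C2_on (\<lambda>(\<rho>, T). A \<rho> T) \<T>" "x \<in> \<T>"
  shows "(\<lambda>(\<rho>, T). eos_\<sigma> A \<rho> T) differentiable (at x)"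
proof -
  let ?A = "\<lambda>(\<rho>, T). A \<rho> T"
  have "(\<lambda>y. - frechet_derivative ?A (at y) (0, 1)) differentiable (at x)"
    using assms unfolding C2_on_def C1_on_def by (intro differentiable_minus) blast
  then obtain D where D: "((\<lambda>y. - frechet_derivative ?A (at y) (0, 1)) has_derivative D) (at x)"
    unfolding differentiable_def by blast
  have "((\<lambda>(\<rho>, T). eos_\<sigma> A \<rho> T) has_derivative D) (at x)"
  proof (rule has_derivative_transform_within_open[OF D \<open>open \<T>\<close> \<open>x \<in> \<T>\<close>])
    fix y assume "y \<in> \<T>"
    moreover obtain \<rho> T where y: "y = (\<rho>, T)" by fastforce
    ultimately have "frechet_derivative ?A (at y) =
        (\<lambda>h. fst h * deriv (\<lambda>r. A r T) \<rho> + snd h * deriv (\<lambda>\<tau>. A \<rho> \<tau>) T)"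
      using frechet_derivative_at[OF eos_A_has_derivative[OF assms(2), of \<rho> T]] by simp
    then show "- frechet_derivative ?A (at y) (0, 1) = (case y of (\<rho>, T) \<Rightarrow> eos_\<sigma> A \<rho> T)"
      by (simp add: y eos_\<sigma>_def)
  qed
  then show ?thesis
    unfolding differentiable_def by blast
qed

text \<open>The Gibbs relation \<open>de = (p / \<rho>\<^sup>2) d\<rho> + T d\<sigma>\<close>: in \<open>e = A + T \<sigma>\<close> the term \<open>\<sigma> dT\<close>
  cancels against the temperature part of \<open>dA\<close>.\<close>

lemma eos_e_has_derivative:
  assumes "open \<T>" "C2_on (\<lambda>(\<rho>, T). A \<rho> T) \<T>" "(\<rho>, T) \<in> \<T>"
    and \<sigma>: "((\<lambda>(\<rho>, T). eos_\<sigma> A \<rho> T) has_derivative (\<lambda>h. fst h * b + snd h * c)) (at (\<rho>, T))"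
  shows "((\<lambda>(\<rho>, T). eos_e A \<rho> T) has_derivative
      (\<lambda>h. fst h * (deriv (\<lambda>r. A r T) \<rho> + T * b) + snd h * (T * c))) (at (\<rho>, T))"
proof -
  have "(\<lambda>(\<rho>, T). eos_e A \<rho> T) = (\<lambda>x. (\<lambda>(\<rho>, T). A \<rho> T) x + snd x * (\<lambda>(\<rho>, T). eos_\<sigma> A \<rho> T) x)"
    by (auto simp: eos_e_def eos_\<sigma>_def fun_eq_iff)
  moreover have "((\<lambda>x. (\<lambda>(\<rho>, T). A \<rho> T) x + snd x * (\<lambda>(\<rho>, T). eos_\<sigma> A \<rho> T) x) has_derivative
      (\<lambda>h. fst h * (deriv (\<lambda>r. A r T) \<rho> + T * b) + snd h * (T * c))) (at (\<rho>, T))"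
    by (rule has_derivative_eq_rhs[OF has_derivative_add[OF eos_A_has_derivative[OF assms(2,3)]
          has_derivative_mult[OF has_derivative_snd[OF has_derivative_ident] \<sigma>]]])
       (simp add: fun_eq_iff eos_\<sigma>_def algebra_simps)
  ultimately show ?thesis
    by simp
qed

lemma eos_partials:
  assumes eos: "arbitrary_eos \<T> A \<U>" and "(\<rho>, T) \<in> \<T>"
  obtains b c where
    "((\<lambda>(\<rho>, T). eos_\<sigma> A \<rho> T) has_derivative (\<lambda>h. fst h * b + snd h * c)) (at (\<rho>, T))"
    "((\<lambda>(\<rho>, T). eos_e A \<rho> T) has_derivative
      (\<lambda>h. fst h * (deriv (\<lambda>r. A r T) \<rho> + T * b) + snd h * (T * c))) (at (\<rho>, T))"
    "DERIV (eos_e A \<rho>) T :> T * c" "T * c > 0"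
proof -
  have o: "open \<T>" and C2: "C2_on (\<lambda>(\<rho>, T). A \<rho> T) \<T>"
    using eos unfolding arbitrary_eos_def by blast+
  have "\<forall>(\<rho>, T)\<in>\<T>. deriv (\<lambda>\<tau>. eos_e A \<rho> \<tau>) T > 0"
    using eos unfolding arbitrary_eos_def by blast
  from bspec[OF this assms(2)] have pos: "deriv (\<lambda>\<tau>. eos_e A \<rho> \<tau>) T > 0"
    by simp
  define b c where "b = deriv (\<lambda>r. eos_\<sigma> A r T) \<rho>" and "c = deriv (\<lambda>s. eos_\<sigma> A \<rho> s) T"
  have \<sigma>: "((\<lambda>(\<rho>, T). eos_\<sigma> A \<rho> T) has_derivative (\<lambda>h. fst h * b + snd h * c)) (at (\<rho>, T))"
    using has_derivative_partials[OF eos_\<sigma>_differentiable[OF o C2 assms(2)]]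
    by (simp add: b_def c_def)
  note e = eos_e_has_derivative[OF o C2 assms(2) \<sigma>]
  have "((\<lambda>s. (\<rho>, s)) has_derivative (\<lambda>h. (0, h))) (at T)"
    by (auto intro!: derivative_eq_intros)
  from has_derivative_compose[OF this e]
  have "((\<lambda>s. eos_e A \<rho> s) has_derivative (\<lambda>h. h * (T * c))) (at T)"
    by simp
  then have D: "DERIV (eos_e A \<rho>) T :> T * c"
    by (simp add: has_field_derivative_def mult_commute_abs)
  then have "T * c > 0"
    using pos by (simp add: DERIV_imp_deriv)
  with that[OF \<sigma> e D] show ?thesis
    by simp
qed

lemma eos_e_isCont:
  assumes "arbitrary_eos \<T> A \<U>" "(\<rho>, T) \<in> \<T>"
  shows "isCont (\<lambda>(\<rho>, T). eos_e A \<rho> T) (\<rho>, T)"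
  by (rule eos_partials[OF assms]) (rule has_derivative_continuous)

lemma eos_e_DERIV_pos:
  assumes "arbitrary_eos \<T> A \<U>" "(\<rho>, T) \<in> \<T>"
  shows "\<exists>y. DERIV (eos_e A \<rho>) T :> y \<and> 0 < y"
  by (rule eos_partials[OF assms]) (rule exI, rule conjI)

section \<open>The temperature as a function of the state\<close>

lemma temp_is_temperature:
  assumes "arbitrary_eos \<T> A \<U>" "w \<in> \<U>"
  shows "is_temperature \<T> A w (temp \<T> A w)"
proof -
  have "\<exists>!T. is_temperature \<T> A w T"
    using assms unfolding arbitrary_eos_def by blast
  then show ?thesis
    unfolding temp_def by (rule theI')
qed

lemma temp_eqI:
  assumes "arbitrary_eos \<T> A \<U>" "w \<in> \<U>" "is_temperature \<T> A w T"
  shows "temp \<T> A w = T"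
proof -
  have "\<exists>!T. is_temperature \<T> A w T"
    using assms unfolding arbitrary_eos_def by blast
  then show ?thesis
    using assms(3) temp_is_temperature[OF assms(1,2)] by blast
qed

lemma dens_temp:
  assumes "arbitrary_eos \<T> A \<U>" "w \<in> \<U>"
  shows "(dens w, temp \<T> A w) \<in> \<T>" "dens w > 0" "temp \<T> A w > 0"
proof -
  show *: "(dens w, temp \<T> A w) \<in> \<T>"
    using temp_is_temperature[OF assms] by (simp add: is_temperature_def)
  have "\<T> \<subseteq> {0<..} \<times> {0<..}"
    using assms(1) unfolding arbitrary_eos_def by blast
  then show "dens w > 0" "temp \<T> A w > 0"
    using * by auto
qed

lemma state_continuous [continuous_intros]:
  "continuous (at w) dens" "continuous (at w) mom" "continuous (at w) energy"
  by (auto simp: dens_def[abs_def] mom_def[abs_def] energy_def[abs_def] intro!: continuous_intros)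

lemma isCont_tendsto_nhds: "isCont f a \<Longrightarrow> (f \<longlongrightarrow> f a) (nhds a)"
  by (simp add: isCont_def tendsto_at_iff_tendsto_nhds)

text \<open>At the temperatures \<open>T - a\<close> and \<open>T + a\<close> the energy equation fails with opposite signs at
  \<open>w\<close>, because \<open>e\<close> increases in \<open>T\<close>. The signs persist for nearby states, so the intermediate value
  theorem yields a solution in between, which uniqueness identifies with the temperature of the
  nearby state.\<close>

lemma temp_continuous:
  assumes eos: "arbitrary_eos \<T> A \<U>" and U: "open \<U>" and w: "w \<in> \<U>"
  shows "continuous (at w) (temp \<T> A)"
proof -
  define T where "T = temp \<T> A w"
  define F where "F s u = dens u * eos_e A (dens u) s - (energy u - (norm (mom u))\<^sup>2 / (2 * dens u))"
    for s and u :: "'a state"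
  have oT: "open \<T>"
    using eos unfolding arbitrary_eos_def by blast
  have r: "(dens w, T) \<in> \<T>" "dens w > 0"
    unfolding T_def by (fact dens_temp[OF eos w])+
  have Fw: "F T w = 0"
    using temp_is_temperature[OF eos w] by (simp add: F_def is_temperature_def T_def)
  have contF: "continuous (at w) (F s)" if s: "(dens w, s) \<in> \<T>" for s
  proof -
    note e = eos_e_isCont[OF eos s]
    have "continuous (at w) (\<lambda>u. (dens u, s))"
      by (intro continuous_intros)
    from isCont_o2[OF this e] have "continuous (at w) (\<lambda>u. eos_e A (dens u) s)"
      by simp
    then show ?thesis
      unfolding F_def using r(2) by (intro continuous_intros) auto
  qed
  obtain R B where RB: "open R" "open B" "dens w \<in> R" "T \<in> B" "R \<times> B \<subseteq> \<T>"
    using open_prod_elim[OF oT r(1)] by (metis mem_Sigma_iff)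
  obtain a0 where a0: "a0 > 0" "cball T a0 \<subseteq> B"
    using RB(2,4) open_contains_cball by blast
  have "eventually (\<lambda>u. dist (temp \<T> A u) T < e) (nhds w)" if e: "e > 0" for e
  proof -
    define a where "a = min a0 (e / 2)"
    have a: "a > 0" "a \<le> a0" "a < e"
      using a0(1) e by (auto simp: a_def)
    have inB: "s \<in> B" if "T - a \<le> s" "s \<le> T + a" for s
    proof -
      have "s \<in> cball T a0"
        using a(2) that by (simp add: dist_real_def abs_if)
      then show ?thesis
        using a0(2) by blast
    qed
    have inT: "(\<rho>, s) \<in> \<T>" if "\<rho> \<in> R" "T - a \<le> s" "s \<le> T + a" for \<rho> s
      by (rule subsetD[OF RB(5)]) (simp add: inB that)
    have e_deriv: "\<exists>y. DERIV (eos_e A \<rho>) s :> y \<and> 0 < y" if "\<rho> \<in> R" "T - a \<le> s" "s \<le> T + a" for \<rho> s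
      by (rule eos_e_DERIV_pos[OF eos inT[OF that]])
    have bounds: "T - a \<le> T" "T \<le> T + a" "T - a < T" "T < T + a" "T - a \<le> T + a"
      using a(1) by auto
    have "eos_e A (dens w) (T - a) < eos_e A (dens w) T"
      by (rule DERIV_pos_imp_increasing) (use bounds e_deriv[OF RB(3)] in auto)
    then have "F (T - a) w < F T w"
      using r(2) by (simp add: F_def)
    then have neg: "F (T - a) w < 0"
      using Fw by simp
    have "isCont (F (T - a)) w"
      using RB(3) bounds by (intro contF inT) auto
    from order_tendstoD(2)[OF isCont_tendsto_nhds[OF this] neg]
    have ev1: "eventually (\<lambda>u. F (T - a) u < 0) (nhds w)" .
    have "eos_e A (dens w) T < eos_e A (dens w) (T + a)"
      by (rule DERIV_pos_imp_increasing) (use bounds e_deriv[OF RB(3)] in auto)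
    then have "F T w < F (T + a) w"
      using r(2) by (simp add: F_def)
    then have pos: "F (T + a) w > 0"
      using Fw by simp
    have "isCont (F (T + a)) w"
      using RB(3) bounds by (intro contF inT) auto
    from order_tendstoD(1)[OF isCont_tendsto_nhds[OF this] pos]
    have ev2: "eventually (\<lambda>u. F (T + a) u > 0) (nhds w)" .
    have ev3: "eventually (\<lambda>u. dens u \<in> R) (nhds w)"
      by (rule topological_tendstoD[OF isCont_tendsto_nhds[OF state_continuous(1)] RB(1,3)])
    have ev4: "eventually (\<lambda>u. u \<in> \<U>) (nhds w)"
      using U w by (rule eventually_nhds_in_open)
    show ?thesis
      using ev1 ev2 ev3 ev4
    proof eventually_elim
      case (elim u)
      have "continuous_on {T - a..T + a} (\<lambda>s. F s u)"
      proof (rule continuous_at_imp_continuous_on, rule ballI)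
        fix s assume "s \<in> {T - a..T + a}"
        then have "T - a \<le> s" "s \<le> T + a"
          by auto
        then obtain y where "DERIV (eos_e A (dens u)) s :> y"
          using e_deriv[OF elim(3)] by blast
        then have "isCont (eos_e A (dens u)) s"
          by (rule DERIV_isCont)
        then show "isCont (\<lambda>s. F s u) s"
          unfolding F_def by (intro continuous_intros)
      qed
      then obtain s where s: "T - a \<le> s" "s \<le> T + a" "F s u = 0"
        using IVT'[of "\<lambda>s. F s u" "T - a" 0 "T + a"] elim(1,2) a(1) by auto
      then have "is_temperature \<T> A u s"
        using inT[OF elim(3)] by (simp add: is_temperature_def F_def)
      then have "temp \<T> A u = s"
        by (rule temp_eqI[OF eos elim(4)])
      then show "dist (temp \<T> A u) T < e"
        using s a(3) by (simp add: dist_real_def)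
    qed
  qed
  then have "filterlim (temp \<T> A) (nhds T) (nhds w)"
    by (rule tendstoI)
  then show ?thesis
    by (simp add: isCont_def tendsto_at_iff_tendsto_nhds T_def)
qed

section \<open>Gradients of kinetic energy and entropy\<close>

lemma state_has_derivative:
  "(dens has_derivative dens) (at w)"
  "(mom has_derivative mom) (at w)"
  "(energy has_derivative energy) (at w)"
  unfolding dens_def[abs_def] mom_def[abs_def] energy_def[abs_def]
  by (intro has_derivative_fst has_derivative_snd has_derivative_ident)+

lemma inner_state: "inner a b = dens a * dens b + inner (mom a) (mom b) + energy a * energy b"
  for a b :: "'d::finite state"
  by (cases a; cases b) (simp add: dens_def mom_def energy_def)

lemma state_simps [simp]:
  "dens (r, m, E) = r" "mom (r, m, E) = m" "energy (r, m, E) = E"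
  "dens (a + b) = dens a + dens b" "mom (a + b) = mom a + mom b" "energy (a + b) = energy a + energy b"
  "dens (a - b) = dens a - dens b" "mom (a - b) = mom a - mom b" "energy (a - b) = energy a - energy b"
  "dens (c *\<^sub>R a) = c * dens a" "mom (c *\<^sub>R a) = c *\<^sub>R mom a" "energy (c *\<^sub>R a) = c * energy a"
  by (simp_all add: dens_def mom_def energy_def)

lemma state_eqI: "dens a = dens b \<Longrightarrow> mom a = mom b \<Longrightarrow> energy a = energy b \<Longrightarrow> a = b"
  by (simp add: dens_def mom_def energy_def prod_eq_iff)

lemma kin_GDERIV:
  assumes "dens w > 0"
  shows "GDERIV kin w :> (- (norm (vel w))\<^sup>2 / 2, vel w, 0)"
proof -
  have "2 * dens w \<noteq> 0"
    using assms by simp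
  from has_derivative_divide[OF has_derivative_inner[OF state_has_derivative(2) state_has_derivative(2)]
      has_derivative_mult_right[OF state_has_derivative(1)] this]
  have D: "((\<lambda>u. inner (mom u) (mom u) / (2 * dens u)) has_derivative
      (\<lambda>h. - inner (mom w) (mom w) * (inverse (2 * dens w) * (2 * dens h) * inverse (2 * dens w))
        + (inner (mom w) (mom h) + inner (mom h) (mom w)) / (2 * dens w))) (at w)" .
  have kin: "kin = (\<lambda>u. inner (mom u) (mom u) / (2 * dens u))"
    by (simp add: fun_eq_iff kin_def power2_norm_eq_inner)
  have "- inner (mom w) (mom w) * (inverse (2 * dens w) * (2 * dens h) * inverse (2 * dens w))
        + (inner (mom w) (mom h) + inner (mom h) (mom w)) / (2 * dens w)
      = inner h (- (norm (vel w))\<^sup>2 / 2, vel w, 0)" for h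
    using assms unfolding inner_state vel_def power2_norm_eq_inner
    by (simp add: inner_commute[of "mom h"] field_simps)
  then show ?thesis
    using D by (simp only: gderiv_def kin)
qed

text \<open>The map \<open>(\<rho>, m, T) \<mapsto> (\<rho>, m, E)\<close> has a triangular derivative with diagonal entry
  \<open>\<rho> \<partial>e/\<partial>T \<noteq> 0\<close>, and \<open>u \<mapsto> (\<rho>, m, T(u))\<close> is a continuous right inverse of it on an open set. Such an
  inverse is differentiable. Points \<open>(\<rho>, m, T)\<close> are again encoded as states, with the temperature
  in the energy slot.\<close>

lemma temp_has_derivative:
  assumes eos: "arbitrary_eos \<T> A \<U>" and U: "open \<U>" and w: "w \<in> \<U>"
    and e: "((\<lambda>(\<rho>, T). eos_e A \<rho> T) has_derivative (\<lambda>h. fst h * a + snd h * c)) (at (dens w, temp \<T> A w))"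
    and c: "c > 0"
  shows "(temp \<T> A has_derivative
     (\<lambda>h. (energy h - (eos_e A (dens w) (temp \<T> A w) + dens w * a - (norm (vel w))\<^sup>2 / 2) * dens h
            - inner (vel w) (mom h)) / (dens w * c))) (at w)"
proof -
  define f where "f x = (dens x, mom x, kin x + dens x * eos_e A (dens x) (energy x))" for x :: "'a state"
  define g where "g x = (dens x, mom x, temp \<T> A x)" for x :: "'a state"
  define e0 where "e0 = eos_e A (dens w) (temp \<T> A w)"
  define f' where "f' h = (dens h, mom h, inner h (- (norm (vel w))\<^sup>2 / 2, vel w, 0)
      + (dens w * (dens h * a + energy h * c) + dens h * e0))" for h :: "'a state"
  define g' where "g' h = (dens h, mom h, (energy h - (e0 + dens w * a - (norm (vel w))\<^sup>2 / 2) * dens h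
            - inner (vel w) (mom h)) / (dens w * c))" for h :: "'a state"
  have r: "dens w > 0"
    by (rule dens_temp[OF eos w])
  have velg: "vel (g w) = vel w"
    by (simp add: vel_def g_def)
  have kin': "(kin has_derivative (\<lambda>h. inner h (- (norm (vel w))\<^sup>2 / 2, vel w, 0))) (at (g w))"
    using kin_GDERIV[of "g w"] r unfolding gderiv_def velg by (simp add: g_def)
  have pair: "((\<lambda>x. (dens x, energy x)) has_derivative (\<lambda>h. (dens h, energy h))) (at (g w))"
    by (intro has_derivative_Pair state_has_derivative)
  have "((\<lambda>x. eos_e A (dens x) (energy x)) has_derivative (\<lambda>h. dens h * a + energy h * c)) (at (g w))"
    using has_derivative_compose[OF pair, of "\<lambda>(\<rho>, T). eos_e A \<rho> T" "\<lambda>h. fst h * a + snd h * c"] e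
    by (simp add: g_def)
  from has_derivative_Pair[OF state_has_derivative(1) has_derivative_Pair[OF state_has_derivative(2)
       has_derivative_add[OF kin' has_derivative_mult[OF state_has_derivative(1) this]]]]
  have f_deriv: "(f has_derivative f') (at (g w))"
    unfolding f_def[abs_def] f'_def[abs_def] e0_def by (simp add: g_def)
  have lin: "bounded_linear g'"
    unfolding g'_def[abs_def]
    using state_has_derivative[THEN has_derivative_bounded_linear]
    by (intro bounded_linear_Pair bounded_linear_compose[OF bounded_linear_divide] bounded_linear_sub
        bounded_linear_compose[OF bounded_linear_mult_right] bounded_linear_compose[OF bounded_linear_inner_right])
  have inv: "g' \<circ> f' = id"
    using r c by (auto simp: fun_eq_iff g'_def f'_def inner_state field_simps inner_commute intro!: state_eqI)
  have contg: "continuous (at w) g"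
    unfolding g_def[abs_def] by (intro continuous_intros temp_continuous[OF eos U w])
  have fg: "f (g z) = z" if "z \<in> \<U>" for z
    using temp_is_temperature[OF eos that] dens_temp(2)[OF eos that]
    by (auto simp: f_def g_def is_temperature_def kin_def field_simps intro!: state_eqI)
  have "(g has_derivative g') (at w)"
    by (rule has_derivative_inverse_basic[OF f_deriv lin inv contg U w fg])
  from has_derivative_snd[OF has_derivative_snd[OF this]]
  show ?thesis
    by (simp add: g_def g'_def e0_def)
qed

text \<open>The classical identity \<open>ds = \<beta> (g d\<rho> - d(\<rho> e))\<close> with
  \<open>d(\<rho> e) = dE - v \<bullet> dm + |v|\<^sup>2 / 2 d\<rho>\<close>. The density derivative \<open>b\<close> of \<open>\<sigma>\<close> enters \<open>e\<close> with the factor \<open>T\<close>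
  and so drops out.\<close>

lemma entropy_GDERIV:
  assumes eos: "arbitrary_eos \<T> A \<U>" and U: "open \<U>" and w: "w \<in> \<U>"
  shows "GDERIV (entropy \<T> A) w :>
    (beta \<T> A w * (eos_g A (dens w) (temp \<T> A w) - (norm (vel w))\<^sup>2 / 2),
     beta \<T> A w *\<^sub>R vel w, - beta \<T> A w)"
proof -
  define r where "r = dens w"
  define T where "T = temp \<T> A w"
  define B where "B = 1 / T"
  have pos: "r > 0" "T > 0" and rT: "(r, T) \<in> \<T>"
    unfolding r_def T_def by (fact dens_temp[OF eos w])+
  obtain b c where \<sigma>: "((\<lambda>(\<rho>, T). eos_\<sigma> A \<rho> T) has_derivative (\<lambda>h. fst h * b + snd h * c)) (at (r, T))"
    and e: "((\<lambda>(\<rho>, T). eos_e A \<rho> T) has_derivative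
      (\<lambda>h. fst h * (deriv (\<lambda>r. A r T) r + T * b) + snd h * (T * c))) (at (r, T))"
    and "DERIV (eos_e A r) T :> T * c" and Tc: "T * c > 0"
    by (rule eos_partials[OF eos rT])
  have c: "c > 0"
    using Tc pos by (simp add: zero_less_mult_iff)
  define a where "a = deriv (\<lambda>r. A r T) r"
  define t where "t h = (energy h - (eos_e A r T + r * (a + T * b) - (norm (vel w))\<^sup>2 / 2) * dens h
      - inner (vel w) (mom h)) / (r * (T * c))" for h :: "'a state"
  have temp': "(temp \<T> A has_derivative t) (at w)"
    using temp_has_derivative[OF eos U w, of "a + T * b" "T * c"] e Tc
    by (simp add: r_def T_def a_def t_def[abs_def])
  have \<sigma>': "((\<lambda>(\<rho>, T). eos_\<sigma> A \<rho> T) has_derivative (\<lambda>h. fst h * b + snd h * c)) (at (dens w, temp \<T> A w))"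
    using \<sigma> by (simp add: r_def T_def)
  from has_derivative_compose[OF has_derivative_Pair[OF state_has_derivative(1) temp'] \<sigma>']
  have "((\<lambda>u. eos_\<sigma> A (dens u) (temp \<T> A u)) has_derivative (\<lambda>h. dens h * b + t h * c)) (at w)"
    by simp
  from has_derivative_mult[OF has_derivative_minus[OF state_has_derivative(1)] this]
  have s: "(entropy \<T> A has_derivative
      (\<lambda>h. - r * (dens h * b + t h * c) + - dens h * eos_\<sigma> A r T)) (at w)"
    by (simp add: entropy_def[abs_def] r_def T_def)
  have "- r * (dens h * b + t h * c) + - dens h * eos_\<sigma> A r T =
      inner h (B * (eos_g A r T - (norm (vel w))\<^sup>2 / 2), B *\<^sub>R vel w, - B)" for h
  proof -
    have "r * (t h * c) = B * (energy h - (eos_e A r T + r * (a + T * b) - (norm (vel w))\<^sup>2 / 2) * dens h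
            - inner (vel w) (mom h))"
      using pos c by (simp add: t_def B_def)
    moreover have "eos_g A r T = eos_e A r T - T * eos_\<sigma> A r T + r * a"
      by (simp add: eos_g_def eos_e_def eos_\<sigma>_def a_def)
    moreover have "B * T = 1"
      using pos by (simp add: B_def)
    ultimately show ?thesis
      unfolding inner_state by (simp add: inner_commute) algebra
  qed
  then have "(\<lambda>h. - r * (dens h * b + t h * c) + - dens h * eos_\<sigma> A r T) =
      (\<lambda>h. inner h (B * (eos_g A r T - (norm (vel w))\<^sup>2 / 2), B *\<^sub>R vel w, - B))"
    by (rule ext)
  with s have "GDERIV (entropy \<T> A) w :> (B * (eos_g A r T - (norm (vel w))\<^sup>2 / 2), B *\<^sub>R vel w, - B)"
    unfolding gderiv_def by (rule has_derivative_eq_rhs)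
  then show ?thesis
    by (simp add: beta_def B_def r_def T_def)
qed

section \<open>Diagonal values of the averaged density and energy\<close>

lemma p\<beta>_state: "p\<beta> A (\<rho>\<beta> \<T> A w) = pres \<T> A w * beta \<T> A w"
  by (simp add: p\<beta>_def \<rho>\<beta>_def pres_def beta_def)

lemma g\<beta>_state: "g\<beta> A (\<rho>\<beta> \<T> A w) = eos_g A (dens w) (temp \<T> A w) * beta \<T> A w"
  by (simp add: g\<beta>_def \<rho>\<beta>_def beta_def)

lemma \<rho>\<beta>_in_domain:
  assumes "arbitrary_eos \<T> A \<U>" "w \<in> \<U>"
  shows "\<rho>\<beta> \<T> A w \<in> \<rho>\<beta>_domain \<T>"
proof -
  have "(\<lambda>(\<rho>, T). (\<rho>, 1 / T)) (dens w, temp \<T> A w) \<in> \<rho>\<beta>_domain \<T>"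
    unfolding \<rho>\<beta>_domain_def using dens_temp(1)[OF assms] by (rule imageI)
  then show ?thesis
    by (simp add: \<rho>\<beta>_def beta_def)
qed

text \<open>The Gibbs-Helmholtz relation: the derivative of \<open>\<beta> A(\<rho>, 1 / \<beta>)\<close> in \<open>\<beta>\<close> is
  \<open>A - T \<partial>A/\<partial>T = e\<close>.\<close>

lemma helmholtz_\<beta>_GDERIV:
  assumes "C2_on (\<lambda>(\<rho>, T). A \<rho> T) \<T>" "(\<rho>, T) \<in> \<T>" "T > 0"
  shows "GDERIV (\<lambda>x. snd x * A (fst x) (1 / snd x)) (\<rho>, 1 / T) :>
    (deriv (\<lambda>r. A r T) \<rho> / T, eos_e A \<rho> T)"
proof -
  have "((\<lambda>x. 1 / snd x) has_derivative (\<lambda>h. - snd h * T\<^sup>2)) (at (\<rho>, 1 / T))"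
    using has_derivative_divide[OF has_derivative_const has_derivative_snd[OF has_derivative_ident],
        of "(\<rho>, 1 / T)" 1 UNIV] assms(3)
    by (simp add: power2_eq_square mult_ac)
  from has_derivative_Pair[OF has_derivative_fst[OF has_derivative_ident] this]
  have pair: "((\<lambda>x. (fst x, 1 / snd x)) has_derivative (\<lambda>h. (fst h, - snd h * T\<^sup>2))) (at (\<rho>, 1 / T))" .
  have "((\<lambda>x. A (fst x) (1 / snd x)) has_derivative
      (\<lambda>h. fst h * deriv (\<lambda>r. A r T) \<rho> + - snd h * T\<^sup>2 * deriv (\<lambda>\<tau>. A \<rho> \<tau>) T)) (at (\<rho>, 1 / T))"
    using has_derivative_compose[OF pair, of "\<lambda>(\<rho>, T). A \<rho> T"] eos_A_has_derivative[OF assms(1,2)]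
    by fastforce
  from has_derivative_mult[OF has_derivative_snd[OF has_derivative_ident] this]
  show ?thesis
    unfolding gderiv_def
    by (rule has_derivative_eq_rhs)
       (use assms(3) in \<open>simp add: fun_eq_iff eos_e_def field_simps power2_eq_square\<close>)
qed

text \<open>Writing \<open>p \<beta> = \<rho> (g \<beta> - \<beta> A)\<close> expresses the gradient of \<open>p \<beta>\<close> by that of \<open>g \<beta>\<close> without
  mentioning second derivatives of \<open>A\<close>; the undifferentiated factor \<open>g \<beta> - \<beta> A\<close> cancels the
  density derivative of \<open>\<beta> A\<close>.\<close>

lemma grad_p\<beta>:
  assumes "C2_on (\<lambda>(\<rho>, T). A \<rho> T) \<T>" "(\<rho>, T) \<in> \<T>" "T > 0"
    and "g\<beta> A differentiable (at (\<rho>, 1 / T))"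
  shows "grad (p\<beta> A) (\<rho>, 1 / T) =
    (\<rho> * fst (grad (g\<beta> A) (\<rho>, 1 / T)), \<rho> * (snd (grad (g\<beta> A) (\<rho>, 1 / T)) - eos_e A \<rho> T))"
proof -
  obtain a b where "(g\<beta> A has_derivative (\<lambda>h. fst h * a + snd h * b)) (at (\<rho>, 1 / T))"
    using has_derivative_partials[OF assms(4)] by blast
  then have g: "GDERIV (g\<beta> A) (\<rho>, 1 / T) :> (a, b)"
    unfolding gderiv_def by (simp add: inner_prod_def)
  let ?\<Phi> = "\<lambda>x. snd x * A (fst x) (1 / snd x)"
  have fst': "GDERIV fst (\<rho>, 1 / T) :> (1, 0)"
    unfolding gderiv_def by (rule has_derivative_eq_rhs[OF has_derivative_fst[OF has_derivative_ident]]) (simp add: fun_eq_iff inner_prod_def)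
  have "p\<beta> A = (\<lambda>x. fst x * (g\<beta> A x - ?\<Phi> x))"
    by (auto simp: fun_eq_iff p\<beta>_def g\<beta>_def eos_p_def eos_g_def algebra_simps power2_eq_square)
  moreover have "g\<beta> A (\<rho>, 1 / T) - ?\<Phi> (\<rho>, 1 / T) = \<rho> * (deriv (\<lambda>r. A r T) \<rho> / T)"
    by (simp add: g\<beta>_def eos_g_def field_simps)
  ultimately have "GDERIV (p\<beta> A) (\<rho>, 1 / T) :> (\<rho> * a, \<rho> * (b - eos_e A \<rho> T))"
    using GDERIV_mult[OF fst' GDERIV_diff[OF g helmholtz_\<beta>_GDERIV[OF assms(1-3)]]]
    by (simp add: algebra_simps)
  then show ?thesis
    using g by (simp add: grad_eqI)
qed

lemma tilde_consistent:
  assumes eos: "arbitrary_eos \<T> A \<U>" and w: "w \<in> \<U>"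
    and Gp: "discrete_gradient (p\<beta> A) (\<rho>\<beta>_domain \<T>) Gp"
    and Gg: "discrete_gradient (g\<beta> A) (\<rho>\<beta>_domain \<T>) Gg"
    and pos: "fst (Gg (\<rho>\<beta> \<T> A w) (\<rho>\<beta> \<T> A w)) > 0"
  shows "\<rho>_tilde \<T> A Gp Gg w w = dens w"
    and "e_tilde \<T> A Gp Gg w w = eos_e A (dens w) (temp \<T> A w)"
proof -
  let ?x = "\<rho>\<beta> \<T> A w"
  have x: "?x \<in> \<rho>\<beta>_domain \<T>"
    by (rule \<rho>\<beta>_in_domain[OF eos w])
  have x_eq: "?x = (dens w, 1 / temp \<T> A w)"
    by (simp add: \<rho>\<beta>_def beta_def)
  have C2: "C2_on (\<lambda>(\<rho>, T). A \<rho> T) \<T>"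
    using eos unfolding arbitrary_eos_def by blast
  have diff: "g\<beta> A differentiable (at ?x)"
    using Gg x unfolding discrete_gradient_def by blast
  have "Gp ?x ?x = grad (p\<beta> A) ?x" and g: "Gg ?x ?x = grad (g\<beta> A) ?x"
    using Gp Gg x unfolding discrete_gradient_def by blast+
  then have "Gp ?x ?x = (dens w * fst (Gg ?x ?x), dens w * (snd (Gg ?x ?x) - eos_e A (dens w) (temp \<T> A w)))"
    using grad_p\<beta>[OF C2 dens_temp(1,3)[OF eos w]] diff by (simp add: x_eq)
  then show *: "\<rho>_tilde \<T> A Gp Gg w w = dens w"
    and "e_tilde \<T> A Gp Gg w w = eos_e A (dens w) (temp \<T> A w)"
    using pos dens_temp(2)[OF eos w] by (simp_all add: \<rho>_tilde_def e_tilde_def)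
qed

section \<open>Jump conditions\<close>

text \<open>Since \<open>\<Delta>v \<bullet> avg v = \<Delta>|v|\<^sup>2 / 2\<close>, the mass flux drops out and only the pressure part
  \<open>avg p \<Delta>v\<^sub>j\<close> of the momentum flux survives.\<close>

lemma kin_jump:
  assumes "dens a > 0" "dens b > 0"
  shows "inner (grad kin b - grad kin a) (num_flux \<T> A Gp Gg j a b) =
    pres \<T> A b * vel b $ j - pres \<T> A a * vel a $ j - kin_work \<T> A j a b"
  unfolding grad_eqI[OF kin_GDERIV[OF assms(1)]] grad_eqI[OF kin_GDERIV[OF assms(2)]]
  by (simp add: num_flux_def flux_m_def kin_work_def avg_def jump_def inner_axis
      power2_norm_eq_inner inner_simps inner_commute[of "vel b" "vel a"] field_simps)

text \<open>With the discrete Gibbs-Duhem relation (\<open>key\<close> below), the thermodynamic part of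
  \<open>\<Delta>\<eta> \<bullet> f\<close> becomes \<open>avg v\<^sub>j \<Delta>(p \<beta>)\<close>. The term \<open>|avg v|\<^sup>2 - avg |v|\<^sup>2 / 2\<close> of the energy flux
  cancels what the mass and momentum parts leave of the velocity terms, and \<open>2 avg v\<^sub>j avg p - avg (v\<^sub>j p)\<close> is what
  completes \<open>avg v\<^sub>j \<Delta>(p \<beta>) + avg p \<Delta>(\<beta> v\<^sub>j)\<close> to \<open>\<Delta>(v\<^sub>j p \<beta>)\<close>.\<close>

lemma entropy_jump:
  assumes eos: "arbitrary_eos \<T> A \<U>" and U: "open \<U>" and a: "a \<in> \<U>" and b: "b \<in> \<U>"
    and Gp: "discrete_gradient (p\<beta> A) (\<rho>\<beta>_domain \<T>) Gp"
    and Gg: "discrete_gradient (g\<beta> A) (\<rho>\<beta>_domain \<T>) Gg"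
    and p_pos: "fst (Gp (\<rho>\<beta> \<T> A a) (\<rho>\<beta> \<T> A b)) > 0"
    and g_pos: "fst (Gg (\<rho>\<beta> \<T> A a) (\<rho>\<beta> \<T> A b)) > 0"
  shows "inner (grad (entropy \<T> A) b - grad (entropy \<T> A) a) (num_flux \<T> A Gp Gg j a b) =
    vel b $ j * pres \<T> A b * beta \<T> A b - vel a $ j * pres \<T> A a * beta \<T> A a"
proof -
  let ?x = "\<rho>\<beta> \<T> A a" and ?y = "\<rho>\<beta> \<T> A b"
  have xy: "?x \<in> \<rho>\<beta>_domain \<T>" "?y \<in> \<rho>\<beta>_domain \<T>"
    by (fact \<rho>\<beta>_in_domain[OF eos a] \<rho>\<beta>_in_domain[OF eos b])+
  define R where "R = \<rho>_tilde \<T> A Gp Gg a b"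
  define e where "e = e_tilde \<T> A Gp Gg a b"
  define ga where "ga = eos_g A (dens a) (temp \<T> A a)"
  define gb where "gb = eos_g A (dens b) (temp \<T> A b)"
  define Ba where "Ba = beta \<T> A a"
  define Bb where "Bb = beta \<T> A b"
  define pa where "pa = pres \<T> A a"
  define pb where "pb = pres \<T> A b"
  define P where "P = Gp ?x ?y"
  define G where "G = Gg ?x ?y"
  have "inner P (?y - ?x) = pb * Bb - pa * Ba"
    using Gp xy unfolding discrete_gradient_def P_def by (simp add: p\<beta>_state pa_def pb_def Ba_def Bb_def)
  then have P: "fst P * (dens b - dens a) + snd P * (Bb - Ba) = pb * Bb - pa * Ba"
    by (simp add: inner_prod_def \<rho>\<beta>_def Ba_def Bb_def)
  have "inner G (?y - ?x) = gb * Bb - ga * Ba"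
    using Gg xy unfolding discrete_gradient_def G_def by (simp add: g\<beta>_state ga_def gb_def Ba_def Bb_def)
  then have G: "fst G * (dens b - dens a) + snd G * (Bb - Ba) = gb * Bb - ga * Ba"
    by (simp add: inner_prod_def \<rho>\<beta>_def Ba_def Bb_def)
  \<comment> \<open>The definitions of the tilde quantities, cleared of denominators.\<close>
  have R_G: "R * fst G = fst P"
    using g_pos by (simp add: R_def \<rho>_tilde_def P_def G_def)
  have "R \<noteq> 0"
    using p_pos g_pos by (simp add: R_def \<rho>_tilde_def)
  then have R_e: "R * (snd G - e) = snd P"
    by (simp add: R_def e_def e_tilde_def P_def G_def)
  have "R * ((gb * Bb - ga * Ba) - e * (Bb - Ba)) = R * fst G * (dens b - dens a) + R * (snd G - e) * (Bb - Ba)"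
    unfolding G[symmetric] by algebra
  also have "\<dots> = pb * Bb - pa * Ba"
    unfolding R_G R_e by (rule P)
  finally have key: "R * ((gb * Bb - ga * Ba) - e * (Bb - Ba)) = pb * Bb - pa * Ba" .
  define x where "x = vel a $ j"
  define y where "y = vel b $ j"
  define n where "n = inner (vel a) (vel a)"
  define m where "m = inner (vel b) (vel b)"
  define q where "q = inner (vel a) (vel b)"
  have "inner (grad (entropy \<T> A) b - grad (entropy \<T> A) a) (num_flux \<T> A Gp Gg j a b) =
     (Bb * (gb - m / 2) - Ba * (ga - n / 2)) * (R * ((x + y) / 2))
     + R * ((x + y) / 2) * (Bb * (q + m) - Ba * (n + q)) / 2 + (pa + pb) / 2 * (Bb * y - Ba * x)
     - (Bb - Ba) * (R * ((x + y) / 2) * e + R * ((x + y) / 2) * ((n + 2 * q + m) / 4 - (n + m) / 4)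
         + (2 * ((x + y) / 2) * ((pa + pb) / 2) - (x * pa + y * pb) / 2))"
    unfolding grad_eqI[OF entropy_GDERIV[OF eos U a]] grad_eqI[OF entropy_GDERIV[OF eos U b]]
    by (simp add: num_flux_def flux_\<rho>_def flux_m_def flux_E_def avg_def inner_axis
      power2_norm_eq_inner inner_simps inner_commute[of "vel b" "vel a"] field_simps
      flip: R_def e_def ga_def gb_def Ba_def Bb_def pa_def pb_def x_def y_def n_def m_def q_def)
  also have "\<dots> = (x + y) / 2 * (R * ((gb * Bb - ga * Ba) - e * (Bb - Ba)))
      + (pa + pb) / 2 * (Bb * y - Ba * x)
      - (Bb - Ba) * ((x + y) * (pa + pb) / 2 - (x * pa + y * pb) / 2)"
    by (simp add: field_simps)
  also have "\<dots> = y * pb * Bb - x * pa * Ba"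
    unfolding key by (simp add: field_simps)
  finally show ?thesis
    by (simp add: x_def y_def pa_def pb_def Ba_def Bb_def)
qed

section \<open>Balance laws of the scheme\<close>

text \<open>By the jump condition, \<open>\<eta> \<bullet> f\<close> with \<open>\<eta>\<close> in the cell equals \<open>F + \<psi> + W / 2\<close> at the right face
  and \<open>F + \<psi> - W / 2\<close> at the left face, with the same cell value of \<open>\<psi>\<close>.\<close>

lemma scheme_balance:
  fixes \<phi> :: "'d::finite state \<Rightarrow> real" and \<psi> :: "'d \<Rightarrow> 'd state \<Rightarrow> real"
  assumes sol: "scheme_solution f \<Delta>x C J \<U> u"
    and \<phi>: "\<And>w. w \<in> \<U> \<Longrightarrow> GDERIV \<phi> w :> \<eta> w"
    and jump: "\<And>j a b. a \<in> \<U> \<Longrightarrow> b \<in> \<U> \<Longrightarrow>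
      inner (\<eta> b - \<eta> a) (f j a b) = \<psi> j b - \<psi> j a - W j a b"
    and F: "\<And>j a b. a \<in> \<U> \<Longrightarrow> b \<in> \<U> \<Longrightarrow> F j a b = inner (avg \<eta> a b) (f j a b) - avg (\<psi> j) a b"
    and I: "I \<in> interior_cells C" and t: "t \<in> J"
  shows "\<exists>D. ((\<lambda>\<tau>. \<phi> (u I \<tau>)) has_real_derivative D) (at t within J) \<and>
        D + (\<Sum>j\<in>UNIV. (face_plus (F j) (\<lambda>K. u K t) I j - face_minus (F j) (\<lambda>K. u K t) I j) / \<Delta>x j)
          + (\<Sum>j\<in>UNIV. (face_plus (W j) (\<lambda>K. u K t) I j + face_minus (W j) (\<lambda>K. u K t) I j) / (2 * \<Delta>x j)) = 0"
proof -
  let ?fp = "\<lambda>j. face_plus (f j) (\<lambda>K. u K t) I j" and ?fm = "\<lambda>j. face_minus (f j) (\<lambda>K. u K t) I j"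
  let ?Fp = "\<lambda>j. face_plus (F j) (\<lambda>K. u K t) I j" and ?Fm = "\<lambda>j. face_minus (F j) (\<lambda>K. u K t) I j"
  let ?Wp = "\<lambda>j. face_plus (W j) (\<lambda>K. u K t) I j" and ?Wm = "\<lambda>j. face_minus (W j) (\<lambda>K. u K t) I j"
  obtain D where D: "(u I has_vector_derivative D) (at t within J)"
    and eq: "D + (\<Sum>j\<in>UNIV. (1 / \<Delta>x j) *\<^sub>R (?fp j - ?fm j)) = 0"
    using sol I t unfolding scheme_solution_def by blast
  have inU: "u I t \<in> \<U>" "u (I + axis j 1) t \<in> \<U>" "u (I - axis j 1) t \<in> \<U>" for j
    using sol I t unfolding scheme_solution_def interior_cells_def by blast+
  have "((\<lambda>\<tau>. \<phi> (u I \<tau>)) has_derivative (\<lambda>h. inner (h *\<^sub>R D) (\<eta> (u I t)))) (at t within J)"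
    using has_derivative_compose[OF D[unfolded has_vector_derivative_def] \<phi>[OF inU(1), unfolded gderiv_def]] .
  then have \<phi>_deriv: "((\<lambda>\<tau>. \<phi> (u I \<tau>)) has_real_derivative inner D (\<eta> (u I t))) (at t within J)"
    by (simp add: has_field_derivative_def mult_commute_abs)
  have face: "inner (?fp j - ?fm j) (\<eta> (u I t)) = (?Fp j - ?Fm j) + (?Wp j + ?Wm j) / 2" for j
    using jump[OF inU(1,2), of j j] jump[OF inU(3,1), of j j]
    unfolding inner_commute[of "?fp j - ?fm j"] unfolding face_plus_def face_minus_def F[OF inU(1,2)] F[OF inU(3,1)]
    by (simp add: avg_def inner_diff_left inner_diff_right inner_add_left field_simps)
  have "inner D (\<eta> (u I t)) = - (\<Sum>j\<in>UNIV. inner (?fp j - ?fm j) (\<eta> (u I t)) / \<Delta>x j)"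
    using eq by (simp add: eq_neg_iff_add_eq_0[symmetric] inner_sum_left sum_negf)
  also have "\<dots> = - (\<Sum>j\<in>UNIV. (?Fp j - ?Fm j) / \<Delta>x j + (?Wp j + ?Wm j) / (2 * \<Delta>x j))"
    unfolding face by (simp add: add_divide_distrib)
  finally have "inner D (\<eta> (u I t)) + (\<Sum>j\<in>UNIV. (?Fp j - ?Fm j) / \<Delta>x j)
      + (\<Sum>j\<in>UNIV. (?Wp j + ?Wm j) / (2 * \<Delta>x j)) = 0"
    by (simp add: sum.distrib)
  with \<phi>_deriv show ?thesis
    by blast
qed

section \<open>Symmetry and consistency of the fluxes\<close>

lemma avg_commute: "avg f a b = avg f b a"
  by (simp add: avg_def add.commute)

lemma avg_same [simp]: "avg f a a = f a"
  by (simp add: avg_def flip: scaleR_2)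

lemma num_flux_commute:
  assumes eos: "arbitrary_eos \<T> A \<U>" and a: "a \<in> \<U>" and b: "b \<in> \<U>"
    and "symmetric_on (\<rho>\<beta>_domain \<T>) Gp" "symmetric_on (\<rho>\<beta>_domain \<T>) Gg"
  shows "num_flux \<T> A Gp Gg j a b = num_flux \<T> A Gp Gg j b a"
proof -
  let ?x = "\<rho>\<beta> \<T> A a" and ?y = "\<rho>\<beta> \<T> A b"
  have G: "Gp ?x ?y = Gp ?y ?x" "Gg ?x ?y = Gg ?y ?x"
    using assms \<rho>\<beta>_in_domain[OF eos a] \<rho>\<beta>_in_domain[OF eos b] unfolding symmetric_on_def by blast+
  have R: "\<rho>_tilde \<T> A Gp Gg a b = \<rho>_tilde \<T> A Gp Gg b a"
    by (simp only: \<rho>_tilde_def G)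
  have e: "e_tilde \<T> A Gp Gg a b = e_tilde \<T> A Gp Gg b a"
    by (simp only: e_tilde_def G R)
  show ?thesis
    unfolding num_flux_def flux_\<rho>_def flux_m_def flux_E_def R e avg_commute[of _ a b] by (rule refl)
qed

lemma kin_flux_consistent:
  assumes r: "dens w > 0" and R: "\<rho>_tilde \<T> A Gp Gg w w = dens w"
  shows "kin_flux \<T> A Gp Gg j w w = kin w * vel w $ j"
proof -
  have "kin w = dens w * inner (vel w) (vel w) / 2"
    using r by (simp add: kin_def vel_def power2_norm_eq_inner)
  then show ?thesis
    unfolding kin_flux_def avg_same grad_eqI[OF kin_GDERIV[OF r]]
    by (simp add: num_flux_def flux_\<rho>_def flux_m_def R inner_axis inner_simps power2_norm_eq_inner field_simps)
qed

text \<open>On the diagonal all velocity terms cancel and \<open>v\<^sub>j \<beta> (\<rho> g - \<rho> e - p)\<close> remains, which is the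
  entropy flux by \<open>g = e - T \<sigma> + p / \<rho>\<close>.\<close>

lemma entropy_flux_consistent:
  assumes eos: "arbitrary_eos \<T> A \<U>" and U: "open \<U>" and w: "w \<in> \<U>"
    and R: "\<rho>_tilde \<T> A Gp Gg w w = dens w"
    and e: "e_tilde \<T> A Gp Gg w w = eos_e A (dens w) (temp \<T> A w)"
  shows "entropy_flux \<T> A Gp Gg j w w = entropy \<T> A w * vel w $ j"
proof -
  define r where "r = dens w"
  define T where "T = temp \<T> A w"
  define B where "B = beta \<T> A w"
  define p where "p = pres \<T> A w"
  define g where "g = eos_g A r T"
  define i where "i = eos_e A r T"
  define n where "n = inner (vel w) (vel w)"
  define x where "x = vel w $ j"
  have "T > 0"
    unfolding T_def by (rule dens_temp(3)[OF eos w])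
  then have BT: "B * T = 1"
    by (simp add: B_def beta_def T_def)
  have gibbs: "r * g - r * i - p = - r * T * eos_\<sigma> A r T"
    by (simp add: g_def i_def p_def pres_def r_def T_def eos_g_def eos_e_def eos_p_def eos_\<sigma>_def
        algebra_simps power2_eq_square)
  have "entropy_flux \<T> A Gp Gg j w w =
      B * (g - n / 2) * (r * x) + B * (r * x * n + p * x)
      - B * (r * x * i + r * x * (n - n / 2) + (2 * x * p - x * p)) - x * p * B"
    unfolding entropy_flux_def avg_same grad_eqI[OF entropy_GDERIV[OF eos U w]]
    by (simp add: num_flux_def flux_\<rho>_def flux_m_def flux_E_def R e inner_axis inner_simps
        power2_norm_eq_inner algebra_simps flip: r_def T_def B_def p_def g_def i_def n_def x_def)
  also have "\<dots> = x * B * (r * g - r * i - p)"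
    by (simp add: field_simps)
  also have "\<dots> = - r * eos_\<sigma> A r T * x * (B * T)"
    unfolding gibbs by (simp add: mult_ac)
  finally show ?thesis
    unfolding BT by (simp add: entropy_def r_def T_def x_def)
qed

section \<open>Kinetic-energy consistency and entropy conservation\<close>

theorem mainTheorem3:
  fixes \<T> :: "(real \<times> real) set"
    and A :: "real \<Rightarrow> real \<Rightarrow> real"
    and \<U> :: "('d::finite) state set"
    and Gp Gg :: "real \<times> real \<Rightarrow> real \<times> real \<Rightarrow> real \<times> real"
    and \<Delta>x :: "'d \<Rightarrow> real"
    and C :: "(int ^ 'd) set"
    and J :: "real set"
    and u :: "int ^ 'd \<Rightarrow> real \<Rightarrow> 'd state"
  assumes "open \<U>"
    and "\<forall>w\<in>\<U>. dens w > 0"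
    and "arbitrary_eos \<T> A \<U>"
    and "discrete_gradient (p\<beta> A) (\<rho>\<beta>_domain \<T>) Gp"
    and "discrete_gradient (g\<beta> A) (\<rho>\<beta>_domain \<T>) Gg"
    and "symmetric_on (\<rho>\<beta>_domain \<T>) Gp"
    and "symmetric_on (\<rho>\<beta>_domain \<T>) Gg"
    and "\<forall>w1\<in>\<U>. \<forall>w2\<in>\<U>. fst (Gp (\<rho>\<beta> \<T> A w1) (\<rho>\<beta> \<T> A w2)) > 0"
    and "\<forall>w1\<in>\<U>. \<forall>w2\<in>\<U>. fst (Gg (\<rho>\<beta> \<T> A w1) (\<rho>\<beta> \<T> A w2)) > 0"
    and "\<forall>j. \<Delta>x j > 0"
    and "is_interval J"
    and "scheme_solution (num_flux \<T> A Gp Gg) \<Delta>x C J \<U> u"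
  shows
    "(\<forall>I\<in>interior_cells C. \<forall>t\<in>J. \<exists>D.
        ((\<lambda>\<tau>. kin (u I \<tau>)) has_real_derivative D) (at t within J) \<and>
        D + (\<Sum>j\<in>UNIV. (face_plus (kin_flux \<T> A Gp Gg j) (\<lambda>K. u K t) I j
                         - face_minus (kin_flux \<T> A Gp Gg j) (\<lambda>K. u K t) I j) / \<Delta>x j)
          + (\<Sum>j\<in>UNIV. (face_plus (kin_work \<T> A j) (\<lambda>K. u K t) I j
                         + face_minus (kin_work \<T> A j) (\<lambda>K. u K t) I j) / (2 * \<Delta>x j)) = 0)
     \<and> (\<forall>j. symmetric_on \<U> (kin_flux \<T> A Gp Gg j) \<and>
             (\<forall>w\<in>\<U>. kin_flux \<T> A Gp Gg j w w = kin w * vel w $ j))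
     \<and> (\<forall>I\<in>interior_cells C. \<forall>t\<in>J. \<exists>D.
        ((\<lambda>\<tau>. entropy \<T> A (u I \<tau>)) has_real_derivative D) (at t within J) \<and>
        D + (\<Sum>j\<in>UNIV. (face_plus (entropy_flux \<T> A Gp Gg j) (\<lambda>K. u K t) I j
                         - face_minus (entropy_flux \<T> A Gp Gg j) (\<lambda>K. u K t) I j) / \<Delta>x j) = 0)
     \<and> (\<forall>j. symmetric_on \<U> (entropy_flux \<T> A Gp Gg j) \<and>
             (\<forall>w\<in>\<U>. entropy_flux \<T> A Gp Gg j w w = entropy \<T> A w * vel w $ j))"
proof -
  note U = assms(1) and pos = assms(2) and eos = assms(3) and Gp = assms(4) and Gg = assms(5)
    and sym = assms(6,7) and Gp_pos = assms(8) and Gg_pos = assms(9) and sol = assms(12)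
  have kin_balance: "\<exists>D. ((\<lambda>\<tau>. kin (u I \<tau>)) has_real_derivative D) (at t within J) \<and>
        D + (\<Sum>j\<in>UNIV. (face_plus (kin_flux \<T> A Gp Gg j) (\<lambda>K. u K t) I j
                         - face_minus (kin_flux \<T> A Gp Gg j) (\<lambda>K. u K t) I j) / \<Delta>x j)
          + (\<Sum>j\<in>UNIV. (face_plus (kin_work \<T> A j) (\<lambda>K. u K t) I j
                         + face_minus (kin_work \<T> A j) (\<lambda>K. u K t) I j) / (2 * \<Delta>x j)) = 0"
    if "I \<in> interior_cells C" "t \<in> J" for I t
  proof (rule scheme_balance[OF sol _ _ _ that])
    fix w assume "w \<in> \<U>"
    then show "GDERIV kin w :> grad kin w"
      using kin_GDERIV[of w] pos grad_eqI by metis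
  next
    fix j a b assume "a \<in> \<U>" "b \<in> \<U>"
    then show "inner (grad kin b - grad kin a) (num_flux \<T> A Gp Gg j a b) =
        pres \<T> A b * vel b $ j - pres \<T> A a * vel a $ j - kin_work \<T> A j a b"
      using pos by (intro kin_jump) auto
  qed (rule kin_flux_def)
  \<comment> \<open>Entropy conservation is the balance law with zero work.\<close>
  have "\<exists>D. ((\<lambda>\<tau>. entropy \<T> A (u I \<tau>)) has_real_derivative D) (at t within J) \<and>
        D + (\<Sum>j\<in>UNIV. (face_plus (entropy_flux \<T> A Gp Gg j) (\<lambda>K. u K t) I j
                         - face_minus (entropy_flux \<T> A Gp Gg j) (\<lambda>K. u K t) I j) / \<Delta>x j)
          + (\<Sum>j\<in>UNIV. (face_plus (\<lambda>_ _. 0) (\<lambda>K. u K t) I j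
                         + face_minus (\<lambda>_ _. 0) (\<lambda>K. u K t) I j) / (2 * \<Delta>x j)) = 0"
    if "I \<in> interior_cells C" "t \<in> J" for I t
  proof (rule scheme_balance[OF sol _ _ _ that])
    fix w assume "w \<in> \<U>"
    then show "GDERIV (entropy \<T> A) w :> grad (entropy \<T> A) w"
      using entropy_GDERIV[OF eos U] grad_eqI by metis
  next
    fix j a b assume "a \<in> \<U>" "b \<in> \<U>"
    then show "inner (grad (entropy \<T> A) b - grad (entropy \<T> A) a) (num_flux \<T> A Gp Gg j a b) =
        vel b $ j * pres \<T> A b * beta \<T> A b - vel a $ j * pres \<T> A a * beta \<T> A a - 0"
      using entropy_jump[OF eos U _ _ Gp Gg] Gp_pos Gg_pos by simp
  qed (rule entropy_flux_def)
  then have entropy_balance: "\<exists>D. ((\<lambda>\<tau>. entropy \<T> A (u I \<tau>)) has_real_derivative D) (at t within J) \<and>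
        D + (\<Sum>j\<in>UNIV. (face_plus (entropy_flux \<T> A Gp Gg j) (\<lambda>K. u K t) I j
                         - face_minus (entropy_flux \<T> A Gp Gg j) (\<lambda>K. u K t) I j) / \<Delta>x j) = 0"
    if "I \<in> interior_cells C" "t \<in> J" for I t
    using that by (simp add: face_plus_def face_minus_def)
  have commute: "kin_flux \<T> A Gp Gg j a b = kin_flux \<T> A Gp Gg j b a"
    "entropy_flux \<T> A Gp Gg j a b = entropy_flux \<T> A Gp Gg j b a" if "a \<in> \<U>" "b \<in> \<U>" for j a b
    unfolding kin_flux_def entropy_flux_def num_flux_commute[OF eos that sym] avg_commute[of _ a b]
    by (rule refl)+
  have symm: "symmetric_on \<U> (kin_flux \<T> A Gp Gg j)" "symmetric_on \<U> (entropy_flux \<T> A Gp Gg j)" for j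
    unfolding symmetric_on_def by (intro ballI commute; assumption)+
  have consistent: "kin_flux \<T> A Gp Gg j w w = kin w * vel w $ j"
    "entropy_flux \<T> A Gp Gg j w w = entropy \<T> A w * vel w $ j" if w: "w \<in> \<U>" for j w
  proof -
    have "fst (Gg (\<rho>\<beta> \<T> A w) (\<rho>\<beta> \<T> A w)) > 0"
      using Gg_pos w by blast
    note tilde = tilde_consistent[OF eos w Gp Gg this]
    show "kin_flux \<T> A Gp Gg j w w = kin w * vel w $ j"
      by (rule kin_flux_consistent[OF _ tilde(1)]) (use pos w in blast)
    show "entropy_flux \<T> A Gp Gg j w w = entropy \<T> A w * vel w $ j"
      by (rule entropy_flux_consistent[OF eos U w tilde])
  qed
  show ?thesis
    by (intro conjI ballI allI kin_balance entropy_balance symm consistent)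
qed

end
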